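(* Let $\lambda\in\mathbb{R}$, let $$J_5=\begin{pmatrix}\lambda&1&0\\0&\lambda&0\\0&0&\lambda\end{pmatrix},$$ and $h>0$. If $\psi,\phi,\theta$ are any real numbers with $\phi\neq 0$, $1-\phi\lambda\theta\neq 0$ and $$\frac{\psi+\phi\lambda(1-\theta)}{1-\phi\lambda\theta}=e^{\lambda h},\qquad \phi\,\frac{1-\theta+\psi\theta}{(1-\phi\lambda\theta)^2}=he^{\lambda h},$$ then the difference scheme $$\frac{\mathbf{x}_{k+1}-\psi\mathbf{x}_k}{\phi}=J_5\big[\theta\mathbf{x}_{k+1}+(1-\theta)\mathbf{x}_k\big]$$ is exact for the system $\mathbf{x}'=J_5\mathbf{x}$.
   Context: A one-step difference scheme with step size $h>0$ for $\mathbf{x}'=M\mathbf{x}$ is called exact if for every initial vector $\mathbf{x}_0$ the sequence $(\mathbf{x}_k)$ it generates satisfies $\mathbf{x}_k=\mathbf{x}(kh)$ for all $k\ge 0$, where $\mathbf{x}(t)$ solves $\mathbf{x}'=M\mathbf{x}$, $\mathbf{x}(0)=\mathbf{x}_0$. *)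

theory Defs
  imports "HOL-Analysis.Analysis"
begin

text \<open>The 3x3 matrix J5 (rows: (l,1,0), (0,l,0), (0,0,l)).\<close>
definition J5 :: "real \<Rightarrow> real^3^3" where
  "J5 l = (\<chi> i j. if i = j then l else if i = 1 \<and> j = 2 then 1 else 0)"

text \<open>x solves x' = M x on all of R with x(0) = x0.\<close>
definition ode_solution :: "real^'n^'n \<Rightarrow> real^'n \<Rightarrow> (real \<Rightarrow> real^'n) \<Rightarrow> bool" where
  "ode_solution M x0 x \<longleftrightarrow> x 0 = x0 \<and> (\<forall>t. (x has_vector_derivative (M *v x t)) (at t))"

text \<open>A sequence generated by the theta-type scheme
  (x_{k+1} - psi x_k)/phi = M (theta x_{k+1} + (1-theta) x_k).\<close>
definition theta_scheme_seq ::
  "real \<Rightarrow> real \<Rightarrow> real \<Rightarrow> real^'n^'n \<Rightarrow> (nat \<Rightarrow> real^'n) \<Rightarrow> bool" where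
  "theta_scheme_seq \<psi> \<phi> \<theta> M xs \<longleftrightarrow>
     (\<forall>k. (1 / \<phi>) *\<^sub>R (xs (Suc k) - \<psi> *\<^sub>R xs k)
          = M *v (\<theta> *\<^sub>R xs (Suc k) + (1 - \<theta>) *\<^sub>R xs k))"

text \<open>Exactness of a one-step scheme (given as a predicate on generated sequences)
  with step size h for x' = M x: for every initial vector the scheme generates a sequence,
  the IVP has a solution, and every generated sequence agrees with the solution at kh.\<close>
definition exact_scheme ::
  "((nat \<Rightarrow> real^'n) \<Rightarrow> bool) \<Rightarrow> real \<Rightarrow> real^'n^'n \<Rightarrow> bool" where
  "exact_scheme gen h M \<longleftrightarrow>
     (\<forall>x0. (\<exists>x. ode_solution M x0 x) \<and> (\<exists>xs. xs 0 = x0 \<and> gen xs) \<and>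
       (\<forall>xs x. xs 0 = x0 \<and> gen xs \<and> ode_solution M x0 x \<longrightarrow>
          (\<forall>k. xs k = x (real k * h))))"

end

theory Submission
  imports Defs
begin

text \<open>Write \<open>J5 = \<lambda> I + N\<close> with \<open>N\<^sup>2 = 0\<close>, so the flow of \<open>x' = J5 x\<close> is
  \<open>e\<^bsup>\<lambda>t\<^esup> (I + t N)\<close>, and the solution of the initial value problem is unique because
  \<open>e\<^bsup>-\<lambda>t\<^esup> (x t - t N x t)\<close> has derivative zero. One step of the scheme is the linear
  equation \<open>(1 - \<phi>\<lambda>\<theta>) v - \<phi>\<theta> N v = (\<psi> + \<phi>\<lambda>(1 - \<theta>)) u + \<phi>(1 - \<theta>) N u\<close> for the new
  iterate \<open>v\<close>. Applying \<open>N\<close> gives \<open>N v = e\<^bsup>\<lambda>h\<^esup> N u\<close>, and substituting back, the two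
  hypotheses say precisely that \<open>v = e\<^bsup>\<lambda>h\<^esup> (u + h N u)\<close>, the flow over one step. Since the
  flow is a one-parameter group, the \<open>k\<close>-th iterate is the solution at time \<open>k h\<close>.\<close>

\<comment> \<open>\<open>exp (t (l I + S))\<close>, whose series terminates when \<open>S \<circ> S = 0\<close>.\<close>
definition nilpotent_flow :: "real \<Rightarrow> ('a::real_vector \<Rightarrow> 'a) \<Rightarrow> real \<Rightarrow> 'a \<Rightarrow> 'a" where
  "nilpotent_flow l S t x = exp (l * t) *\<^sub>R (x + t *\<^sub>R S x)"

lemma nilpotent_flow_0 [simp]: "nilpotent_flow l S 0 x = x"
  by (simp add: nilpotent_flow_def)

context
  fixes S :: "'a::real_normed_vector \<Rightarrow> 'a"
  assumes linear_S: "linear S" and nilpotent_S: "\<And>x. S (S x) = 0"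
begin

lemmas S_linear = linear_add[OF linear_S] linear_diff[OF linear_S] linear_scale[OF linear_S]

lemma nil_nilpotent_flow: "S (nilpotent_flow l S t x) = exp (l * t) *\<^sub>R S x"
  by (simp add: nilpotent_flow_def S_linear nilpotent_S)

lemma nilpotent_flow_add: "nilpotent_flow l S (s + t) x = nilpotent_flow l S s (nilpotent_flow l S t x)"
proof -
  have "nilpotent_flow l S s (nilpotent_flow l S t x) =
      exp (l * s) *\<^sub>R (exp (l * t) *\<^sub>R (x + t *\<^sub>R S x) + s *\<^sub>R exp (l * t) *\<^sub>R S x)"
    by (simp add: nilpotent_flow_def nil_nilpotent_flow[unfolded nilpotent_flow_def])
  also have "\<dots> = nilpotent_flow l S (s + t) x"
    by (simp add: nilpotent_flow_def distrib_left exp_add scaleR_add_right scaleR_add_left mult_ac)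
  finally show ?thesis ..
qed

lemma nilpotent_flow_iterate_iff:
  "(\<forall>k. xs (Suc k) = nilpotent_flow l S h (xs k)) \<longleftrightarrow>
    (\<forall>k. xs k = nilpotent_flow l S (real k * h) (xs 0))"
proof
  assume step: "\<forall>k. xs (Suc k) = nilpotent_flow l S h (xs k)"
  show "\<forall>k. xs k = nilpotent_flow l S (real k * h) (xs 0)"
  proof
    fix k
    show "xs k = nilpotent_flow l S (real k * h) (xs 0)"
      by (induction k) (simp_all add: step nilpotent_flow_add[symmetric] algebra_simps)
  qed
next
  assume "\<forall>k. xs k = nilpotent_flow l S (real k * h) (xs 0)"
  then show "\<forall>k. xs (Suc k) = nilpotent_flow l S h (xs k)"
    by (metis nilpotent_flow_add add.commute of_nat_Suc distrib_right mult_1)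
qed

context
  assumes bounded_S: "bounded_linear S"
begin

lemma nilpotent_flow_has_vector_derivative:
  "((\<lambda>t. nilpotent_flow l S t x) has_vector_derivative
      l *\<^sub>R nilpotent_flow l S t x + S (nilpotent_flow l S t x)) (at t)"
proof -
  have "((\<lambda>t. nilpotent_flow l S t x) has_vector_derivative
      (exp (l * t) * l) *\<^sub>R (x + t *\<^sub>R S x) + exp (l * t) *\<^sub>R S x) (at t)"
    unfolding nilpotent_flow_def by (auto intro!: derivative_eq_intros)
  then show ?thesis
    by (simp add: nilpotent_flow_def nil_nilpotent_flow[unfolded nilpotent_flow_def] mult.commute)
qed

lemma nilpotent_ode_unique:
  assumes x0: "x 0 = x0"
    and ode: "\<And>t. (x has_vector_derivative l *\<^sub>R x t + S (x t)) (at t)"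
  shows "x t = nilpotent_flow l S t x0"
proof -
  define y where "y t = exp (- (l * t)) *\<^sub>R (x t - t *\<^sub>R S (x t))" for t
  have y': "(y has_vector_derivative 0) (at t)" for t
  proof -
    have Sx: "((\<lambda>t. S (x t)) has_vector_derivative l *\<^sub>R S (x t)) (at t)"
      using bounded_linear.has_vector_derivative[OF bounded_S ode[of t]]
      by (simp add: S_linear nilpotent_S)
    show ?thesis
      unfolding y_def
      by (auto intro!: derivative_eq_intros ode Sx simp: algebra_simps)
  qed
  obtain c where "\<And>t. y t = c"
    using has_vector_derivative_zero_constant[OF convex_UNIV, where f = y] y' by auto
  then have "y t = y 0"
    by simp
  then have "exp (- (l * t)) *\<^sub>R (x t - t *\<^sub>R S (x t)) = x0"
    by (simp add: y_def x0)
  then have drift: "x t - t *\<^sub>R S (x t) = exp (l * t) *\<^sub>R x0"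
    by (metis exp_minus_inverse scaleR_one scaleR_scaleR)
  then have "S (x t) = exp (l * t) *\<^sub>R S x0"
    by (metis (no_types) S_linear nilpotent_S scaleR_zero_right diff_zero)
  with drift show ?thesis
    by (simp add: nilpotent_flow_def algebra_simps)
qed

end

lemma theta_step_nilpotent_iff:
  fixes l h \<psi> \<phi> \<theta> :: real
  assumes "\<phi> \<noteq> 0" and "1 - \<phi> * l * \<theta> \<noteq> 0"
    and "(\<psi> + \<phi> * l * (1 - \<theta>)) / (1 - \<phi> * l * \<theta>) = exp (l * h)"
    and "\<phi> * ((1 - \<theta> + \<psi> * \<theta>) / (1 - \<phi> * l * \<theta>)\<^sup>2) = h * exp (l * h)"
  shows "(1 / \<phi>) *\<^sub>R (v - \<psi> *\<^sub>R u) = l *\<^sub>R (\<theta> *\<^sub>R v + (1 - \<theta>) *\<^sub>R u) + S (\<theta> *\<^sub>R v + (1 - \<theta>) *\<^sub>R u)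
    \<longleftrightarrow> v = nilpotent_flow l S h u"
proof -
  define E D where "E = exp (l * h)" and "D = 1 - \<phi> * l * \<theta>"
  have "D \<noteq> 0" using assms(2) by (simp add: D_def)
  have growth: "\<psi> + \<phi> * l * (1 - \<theta>) = E * D"
    using assms(3) \<open>D \<noteq> 0\<close> by (simp add: E_def D_def field_simps)
  have shear: "D * (h * E) = \<phi> * (\<theta> * E + (1 - \<theta>))"
  proof -
    have "D * (\<theta> * E + (1 - \<theta>)) = \<theta> * (E * D) + (1 - \<theta>) * D"
      by (simp add: algebra_simps)
    also have "\<dots> = 1 - \<theta> + \<psi> * \<theta>"
      unfolding growth[symmetric] by (simp add: D_def algebra_simps)
    finally have num: "D * (\<theta> * E + (1 - \<theta>)) = 1 - \<theta> + \<psi> * \<theta>" .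
    have "h * E = \<phi> * ((1 - \<theta> + \<psi> * \<theta>) / D\<^sup>2)"
      using assms(4) by (simp add: E_def D_def)
    also have "\<dots> = \<phi> * (\<theta> * E + (1 - \<theta>)) / D"
      unfolding num[symmetric] using \<open>D \<noteq> 0\<close> by (simp add: power2_eq_square)
    finally show ?thesis
      using \<open>D \<noteq> 0\<close> by (simp add: field_simps)
  qed
  have "(1 / \<phi>) *\<^sub>R (v - \<psi> *\<^sub>R u) = l *\<^sub>R (\<theta> *\<^sub>R v + (1 - \<theta>) *\<^sub>R u) + S (\<theta> *\<^sub>R v + (1 - \<theta>) *\<^sub>R u)
    \<longleftrightarrow> D *\<^sub>R v - (\<phi> * \<theta>) *\<^sub>R S v = (E * D) *\<^sub>R u + (\<phi> * (1 - \<theta>)) *\<^sub>R S u"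
  proof -
    have "(D *\<^sub>R v - (\<phi> * \<theta>) *\<^sub>R S v) - ((E * D) *\<^sub>R u + (\<phi> * (1 - \<theta>)) *\<^sub>R S u)
      = \<phi> *\<^sub>R ((1 / \<phi>) *\<^sub>R (v - \<psi> *\<^sub>R u)
          - (l *\<^sub>R (\<theta> *\<^sub>R v + (1 - \<theta>) *\<^sub>R u) + S (\<theta> *\<^sub>R v + (1 - \<theta>) *\<^sub>R u)))"
      unfolding S_linear growth[symmetric] unfolding D_def using \<open>\<phi> \<noteq> 0\<close> by (simp add: algebra_simps)
    then show ?thesis
      using \<open>\<phi> \<noteq> 0\<close> by (metis eq_iff_diff_eq_0 scaleR_eq_0_iff)
  qed
  also have "\<dots> \<longleftrightarrow> v = E *\<^sub>R u + (h * E) *\<^sub>R S u"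
  proof
    assume step: "D *\<^sub>R v - (\<phi> * \<theta>) *\<^sub>R S v = (E * D) *\<^sub>R u + (\<phi> * (1 - \<theta>)) *\<^sub>R S u"
    \<comment> \<open>Applying \<open>S\<close> leaves a scalar equation for \<open>S v\<close>.\<close>
    have "D *\<^sub>R S v = (E * D) *\<^sub>R S u"
      using arg_cong[OF step, of S] by (simp add: S_linear nilpotent_S)
    then have "S v = E *\<^sub>R S u"
      using \<open>D \<noteq> 0\<close> by (metis mult.commute scaleR_cancel_left scaleR_scaleR)
    then have "D *\<^sub>R v = (E * D) *\<^sub>R u + (\<phi> * (\<theta> * E + (1 - \<theta>))) *\<^sub>R S u"
      using step by (simp add: algebra_simps)
    also have "\<dots> = D *\<^sub>R (E *\<^sub>R u + (h * E) *\<^sub>R S u)"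
      unfolding shear[symmetric] by (simp add: algebra_simps)
    finally have "D *\<^sub>R v = D *\<^sub>R (E *\<^sub>R u + (h * E) *\<^sub>R S u)" .
    then show "v = E *\<^sub>R u + (h * E) *\<^sub>R S u"
      using \<open>D \<noteq> 0\<close> by simp
  next
    assume v: "v = E *\<^sub>R u + (h * E) *\<^sub>R S u"
    then have "S v = E *\<^sub>R S u"
      by (simp add: S_linear nilpotent_S)
    then have "D *\<^sub>R v - (\<phi> * \<theta>) *\<^sub>R S v = (E * D) *\<^sub>R u + (D * (h * E) - \<phi> * \<theta> * E) *\<^sub>R S u"
      using v by (simp add: algebra_simps)
    also have "D * (h * E) - \<phi> * \<theta> * E = \<phi> * (1 - \<theta>)"
      using shear by (simp add: algebra_simps)
    finally show "D *\<^sub>R v - (\<phi> * \<theta>) *\<^sub>R S v = (E * D) *\<^sub>R u + (\<phi> * (1 - \<theta>)) *\<^sub>R S u" .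
  qed
  also have "\<dots> \<longleftrightarrow> v = nilpotent_flow l S h u"
    by (simp add: nilpotent_flow_def E_def scaleR_add_right mult.commute)
  finally show ?thesis .
qed

end

definition J5_nil :: "real^3^3" where
  "J5_nil = (\<chi> i j. if i = 1 \<and> j = 2 then 1 else 0)"

lemma J5_mult_vec: "J5 l *v x = l *\<^sub>R x + J5_nil *v x"
  by (simp add: vec_eq_iff forall_3 J5_def J5_nil_def matrix_vector_mult_def sum_3)

lemma J5_nil_nilpotent: "J5_nil *v (J5_nil *v x) = 0"
  by (simp add: vec_eq_iff forall_3 J5_nil_def matrix_vector_mult_def sum_3)

lemmas J5_nil_linear_nilpotent = matrix_vector_mul_linear J5_nil_nilpotent

lemma ode_solution_J5_iff:
  "ode_solution (J5 l) x0 x \<longleftrightarrow> x = (\<lambda>t. nilpotent_flow l ((*v) J5_nil) t x0)"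
proof
  assume "ode_solution (J5 l) x0 x"
  then have "x t = nilpotent_flow l ((*v) J5_nil) t x0" for t
    by (intro nilpotent_ode_unique[OF J5_nil_linear_nilpotent matrix_vector_mul_bounded_linear]) (simp_all add: ode_solution_def J5_mult_vec)
  then show "x = (\<lambda>t. nilpotent_flow l ((*v) J5_nil) t x0)" ..
next
  assume "x = (\<lambda>t. nilpotent_flow l ((*v) J5_nil) t x0)"
  then show "ode_solution (J5 l) x0 x"
    using nilpotent_flow_has_vector_derivative[OF J5_nil_linear_nilpotent matrix_vector_mul_bounded_linear]
    by (simp add: ode_solution_def J5_mult_vec)
qed

lemma theta_scheme_seq_J5_iff:
  assumes "\<phi> \<noteq> 0" and "1 - \<phi> * l * \<theta> \<noteq> 0"
    and "(\<psi> + \<phi> * l * (1 - \<theta>)) / (1 - \<phi> * l * \<theta>) = exp (l * h)"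
    and "\<phi> * ((1 - \<theta> + \<psi> * \<theta>) / (1 - \<phi> * l * \<theta>)\<^sup>2) = h * exp (l * h)"
  shows "theta_scheme_seq \<psi> \<phi> \<theta> (J5 l) xs \<longleftrightarrow>
    (\<forall>k. xs (Suc k) = nilpotent_flow l ((*v) J5_nil) h (xs k))"
proof -
  have "(1 / \<phi>) *\<^sub>R (v - \<psi> *\<^sub>R u) = J5 l *v (\<theta> *\<^sub>R v + (1 - \<theta>) *\<^sub>R u) \<longleftrightarrow>
      v = nilpotent_flow l ((*v) J5_nil) h u" for u v
    unfolding J5_mult_vec by (rule theta_step_nilpotent_iff[OF J5_nil_linear_nilpotent assms])
  then show ?thesis
    by (simp add: theta_scheme_seq_def)
qed

theorem theorem9:
  fixes l h \<psi> \<phi> \<theta> :: real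
  assumes "h > 0"
    and "\<phi> \<noteq> 0"
    and "1 - \<phi> * l * \<theta> \<noteq> 0"
    and "(\<psi> + \<phi> * l * (1 - \<theta>)) / (1 - \<phi> * l * \<theta>) = exp (l * h)"
    and "\<phi> * ((1 - \<theta> + \<psi> * \<theta>) / (1 - \<phi> * l * \<theta>)\<^sup>2) = h * exp (l * h)"
  shows "exact_scheme (theta_scheme_seq \<psi> \<phi> \<theta> (J5 l)) h (J5 l)"
  unfolding exact_scheme_def ode_solution_J5_iff theta_scheme_seq_J5_iff[OF assms(2-5)]
    nilpotent_flow_iterate_iff[OF J5_nil_linear_nilpotent]
proof (rule allI, intro conjI)
  fix x0
  show "\<exists>xs. xs 0 = x0 \<and> (\<forall>k. xs k = nilpotent_flow l ((*v) J5_nil) (real k * h) (xs 0))"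
    by (intro exI[of _ "\<lambda>k. nilpotent_flow l ((*v) J5_nil) (real k * h) x0"]) simp
qed blast+

end
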